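(* Let $N\ge 2$, let $A^{(n)}\in\mathbb{R}^{I_n\times R}$ ($n=1,\dots,N$), $T=\sum_n I_n$, and let $H=J^TJ\in\mathbb{R}^{RT\times RT}$ be the approximate Hessian of the rank-$R$ CP model at $(A^{(1)},\dots,A^{(N)})$ (see context). Put $C^{(n)}=A^{(n)T}A^{(n)}$, $\Gamma^{(n,m)}=\circledast_{k\neq n,m}C^{(k)}$, $\Gamma^{(n)}=\Gamma^{(n,n)}$, and let $K=[K^{(n,m)}]_{n,m=1}^N\in\mathbb{R}^{NR^2\times NR^2}$ be the block matrix with blocks $K^{(n,m)}=(1-\delta_{n,m})\,P_R\,\operatorname{diag}(\operatorname{vec}(\Gamma^{(n,m)}))\in\mathbb{R}^{R^2\times R^2}$. Then $$H=G+Z\,K\,Z^T,$$ where $$G=\operatorname{blkdiag}\big(\Gamma^{(n)}\otimes I_{I_n}\big)_{n=1}^N\in\mathbb{R}^{RT\times RT},\qquad Z=\operatorname{blkdiag}\big(I_R\otimes A^{(n)}\big)_{n=1}^N\in\mathbb{R}^{RT\times NR^2}.$$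
   Context: Notation: $\otimes$ is the Kronecker product, $\circledast$ the Hadamard (entrywise) product; $\circledast_{k\ne n,m}$ is over all $k\in\{1,\dots,N\}\setminus\{n,m\}$, and an empty Hadamard product of $R\times R$ matrices is the all-ones matrix. $\delta_{n,m}$ is the Kronecker delta. $\operatorname{vec}$ of a matrix stacks its columns; $\operatorname{vec}$ of a tensor lists entries with the first index running fastest. $P_R$ is the $R^2\times R^2$ permutation matrix with $P_R\operatorname{vec}(X^T)=\operatorname{vec}(X)$ for every $R\times R$ matrix $X$. $\operatorname{blkdiag}(M_n)_{n=1}^N$ is the block diagonal matrix with (possibly rectangular) diagonal blocks $M_1,\dots,M_N$. CP model: with $a^{(n)}_r$ the $r$-th column of $A^{(n)}$, $\widehat{\mathcal{Y}}=\sum_{r=1}^R a^{(1)}_r\circ\cdots\circ a^{(N)}_r\in\mathbb{R}^{I_1\times\cdots\times I_N}$ ($\circ$ the outer product). The parameter vector is $a=[\operatorname{vec}(A^{(1)})^T,\dots,\operatorname{vec}(A^{(N)})^T]^T\in\mathbb{R}^{RT}$, and $J\in\mathbb{R}^{(\prod_n I_n)\times RT}$ is the Jacobian of $\operatorname{vec}(\widehat{\mathcal{Y}})$ with respect to $a$. *)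

theory Defs
  imports "HOL-Analysis.Derivative" "Jordan_Normal_Form.Matrix"
begin

unbundle no vec_syntax
hide_const (open) Finite_Cartesian_Product.vec Finite_Cartesian_Product.mat

(* All indices start at 0: modes are n < N, mode sizes are I n, columns are r < R. *)

definition vec_mat :: "'a mat \<Rightarrow> 'a vec" where
  "vec_mat M = Matrix.vec (dim_row M * dim_col M)
     (\<lambda>p. M $$ (p mod dim_row M, p div dim_row M))"

definition kronecker :: "'a::times mat \<Rightarrow> 'a mat \<Rightarrow> 'a mat" (infixl "\<otimes>\<^sub>K" 70) where
  "A \<otimes>\<^sub>K B = Matrix.mat (dim_row A * dim_row B) (dim_col A * dim_col B)
     (\<lambda>(i, j). A $$ (i div dim_row B, j div dim_col B) * B $$ (i mod dim_row B, j mod dim_col B))"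

definition hadamard_prod :: "nat \<Rightarrow> nat set \<Rightarrow> (nat \<Rightarrow> 'a::comm_monoid_mult mat) \<Rightarrow> 'a mat" where
  "hadamard_prod R S M = Matrix.mat R R (\<lambda>(i, j). \<Prod>k\<in>S. M k $$ (i, j))"

definition block_mat :: "nat \<Rightarrow> nat \<Rightarrow> nat \<Rightarrow> (nat \<Rightarrow> nat \<Rightarrow> 'a mat) \<Rightarrow> 'a mat" where
  "block_mat N p q B = Matrix.mat (N * p) (N * q)
     (\<lambda>(i, j). B (i div p) (j div q) $$ (i mod p, j mod q))"

(* Position r + c * R of vec X holds X (r, c), so row p has its 1 in the column q where
   vec (transpose X) holds the same entry; see commutation_mat_mult_vec. *)
definition commutation_mat :: "nat \<Rightarrow> 'a::zero_neq_one mat" where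
  "commutation_mat R = Matrix.mat (R\<^sup>2) (R\<^sup>2)
     (\<lambda>(p, q). if p mod R = q div R \<and> p div R = q mod R then 1 else 0)"

(* An order-N tensor is a function on multi-indices i, read only at i k < I k for k < N. *)

definition multi_index :: "(nat \<Rightarrow> nat) \<Rightarrow> nat \<Rightarrow> nat \<Rightarrow> nat" where
  "multi_index I p k = (p div (\<Prod>l<k. I l)) mod I k"

(* The inverse of multi_index: the position of a multi-index, first index fastest. *)
definition linear_index :: "nat \<Rightarrow> (nat \<Rightarrow> nat) \<Rightarrow> (nat \<Rightarrow> nat) \<Rightarrow> nat" where
  "linear_index N I i = (\<Sum>k<N. i k * (\<Prod>l<k. I l))"

definition vec_tensor :: "nat \<Rightarrow> (nat \<Rightarrow> nat) \<Rightarrow> ((nat \<Rightarrow> nat) \<Rightarrow> 'a) \<Rightarrow> 'a vec" where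
  "vec_tensor N I Y = Matrix.vec (\<Prod>k<N. I k) (\<lambda>p. Y (multi_index I p))"

definition outer_prod :: "nat \<Rightarrow> (nat \<Rightarrow> 'a::comm_monoid_mult vec) \<Rightarrow> (nat \<Rightarrow> nat) \<Rightarrow> 'a" where
  "outer_prod N u = (\<lambda>i. \<Prod>n<N. u n $ i n)"

definition cp_tensor :: "nat \<Rightarrow> nat \<Rightarrow> (nat \<Rightarrow> real mat) \<Rightarrow> (nat \<Rightarrow> nat) \<Rightarrow> real" where
  "cp_tensor N R A = (\<lambda>i. \<Sum>r<R. outer_prod N (\<lambda>n. col (A n) r) i)"

definition cp_params :: "nat \<Rightarrow> (nat \<Rightarrow> real mat) \<Rightarrow> real vec" where
  "cp_params N A = vec_of_list (concat (map (\<lambda>n. list_of_vec (vec_mat (A n))) [0..<N]))"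

(* Recovers the n-th factor matrix from the parameter vector, see cp_factor_cp_params. *)
definition cp_factor :: "(nat \<Rightarrow> nat) \<Rightarrow> nat \<Rightarrow> real vec \<Rightarrow> nat \<Rightarrow> real mat" where
  "cp_factor I R a n =
     Matrix.mat (I n) R (\<lambda>(i, r). a $ (R * (\<Sum>l<n. I l) + r * I n + i))"

definition cp_model :: "nat \<Rightarrow> (nat \<Rightarrow> nat) \<Rightarrow> nat \<Rightarrow> real vec \<Rightarrow> real vec" where
  "cp_model N I R a = vec_tensor N I (cp_tensor N R (cp_factor I R a))"

definition jacobian :: "(real vec \<Rightarrow> real vec) \<Rightarrow> real vec \<Rightarrow> real mat" where
  "jacobian f x = Matrix.mat (dim_vec (f x)) (dim_vec x)
     (\<lambda>(p, q). deriv (\<lambda>t. f (x + t \<cdot>\<^sub>v unit_vec (dim_vec x) q) $ p) 0)"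

definition cp_jacobian :: "nat \<Rightarrow> (nat \<Rightarrow> nat) \<Rightarrow> nat \<Rightarrow> (nat \<Rightarrow> real mat) \<Rightarrow> real mat" where
  "cp_jacobian N I R A = jacobian (cp_model N I R) (cp_params N A)"

definition cp_hessian :: "nat \<Rightarrow> (nat \<Rightarrow> nat) \<Rightarrow> nat \<Rightarrow> (nat \<Rightarrow> real mat) \<Rightarrow> real mat" where
  "cp_hessian N I R A = transpose_mat (cp_jacobian N I R A) * cp_jacobian N I R A"

definition cp_gram :: "(nat \<Rightarrow> real mat) \<Rightarrow> nat \<Rightarrow> real mat" where
  "cp_gram A n = transpose_mat (A n) * A n"

definition cp_Gamma :: "nat \<Rightarrow> nat \<Rightarrow> (nat \<Rightarrow> real mat) \<Rightarrow> nat \<Rightarrow> nat \<Rightarrow> real mat" where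
  "cp_Gamma N R A n m = hadamard_prod R ({..<N} - {n, m}) (cp_gram A)"

definition cp_K :: "nat \<Rightarrow> nat \<Rightarrow> (nat \<Rightarrow> real mat) \<Rightarrow> real mat" where
  "cp_K N R A = block_mat N (R\<^sup>2) (R\<^sup>2)
     (\<lambda>n m. (1 - of_bool (n = m)) \<cdot>\<^sub>m
       (commutation_mat R * mat_diag (R\<^sup>2) (\<lambda>p. vec_mat (cp_Gamma N R A n m) $ p)))"

definition cp_G :: "nat \<Rightarrow> (nat \<Rightarrow> nat) \<Rightarrow> nat \<Rightarrow> (nat \<Rightarrow> real mat) \<Rightarrow> real mat" where
  "cp_G N I R A = diag_block_mat (map (\<lambda>n. cp_Gamma N R A n n \<otimes>\<^sub>K 1\<^sub>m (I n)) [0..<N])"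

definition cp_Z :: "nat \<Rightarrow> nat \<Rightarrow> (nat \<Rightarrow> real mat) \<Rightarrow> real mat" where
  "cp_Z N R A = diag_block_mat (map (\<lambda>n. 1\<^sub>m R \<otimes>\<^sub>K A n) [0..<N])"

lemma dim_vec_mat [simp]: "dim_vec (vec_mat M) = dim_row M * dim_col M"
  by (simp add: vec_mat_def)

lemma commutation_mat_mult_vec:
  fixes X :: "'a::comm_semiring_1 mat"
  assumes X: "X \<in> carrier_mat R R"
  shows "commutation_mat R *\<^sub>v vec_mat (transpose_mat X) = vec_mat X"
proof (rule eq_vecI)
  show "dim_vec (commutation_mat R *\<^sub>v vec_mat (transpose_mat X)) = dim_vec (vec_mat X)"
    using X by (simp add: commutation_mat_def power2_eq_square)
next
  fix p assume "p < dim_vec (vec_mat X)"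
  then have p: "p < R * R" using X by simp
  then have R: "0 < R" by (cases R) auto
  define s where "s = p mod R * R + p div R"
  have pd: "p div R < R" using p by (simp add: less_mult_imp_div_less)
  have pm: "p mod R < R" using R by simp
  have sR: "s < R * R"
  proof -
    have "s < Suc (p mod R) * R" using pd by (simp add: s_def)
    also have "\<dots> \<le> R * R" using pm by (intro mult_right_mono) auto
    finally show ?thesis .
  qed
  have iff: "(p mod R = q div R \<and> p div R = q mod R) \<longleftrightarrow> q = s" for q
    using pd R by (auto simp: s_def)
  have "(commutation_mat R *\<^sub>v vec_mat (transpose_mat X)) $ p
      = (\<Sum>q<R * R. (if q = s then 1 else 0) * vec_mat (transpose_mat X) $ q)"
    using p X by (auto simp: commutation_mat_def scalar_prod_def power2_eq_square iff lessThan_atLeast0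
        intro!: sum.cong)
  also have "\<dots> = (\<Sum>q<R * R. if q = s then vec_mat (transpose_mat X) $ q else 0)"
    by (intro sum.cong) auto
  also have "\<dots> = vec_mat (transpose_mat X) $ s"
    using sR by (simp add: sum.delta)
  also have "\<dots> = vec_mat X $ p"
    using X p sR pd pm R by (simp add: vec_mat_def s_def)
  finally show "(commutation_mat R *\<^sub>v vec_mat (transpose_mat X)) $ p = vec_mat X $ p" .
qed

lemma linear_index_multi_index:
  "p < (\<Prod>k<N. I k) \<Longrightarrow> linear_index N I (multi_index I p) = p"
proof -
  have "linear_index N I (multi_index I p) = p mod (\<Prod>k<N. I k)"
  proof (induction N)
    case (Suc N)
    have "p mod ((\<Prod>k<N. I k) * I N) = (\<Prod>k<N. I k) * (p div (\<Prod>k<N. I k) mod I N) + p mod (\<Prod>k<N. I k)"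
      by (rule mod_mult2_eq)
    with Suc show ?case by (simp add: linear_index_def multi_index_def mult.commute add.commute)
  qed (simp add: linear_index_def)
  then show "p < (\<Prod>k<N. I k) \<Longrightarrow> linear_index N I (multi_index I p) = p" by simp
qed

lemma multi_index_less:
  assumes "p < (\<Prod>k<N. I k)" "k < N"
  shows "multi_index I p k < I k"
proof -
  have "(\<Prod>k<N. I k) \<noteq> 0" using assms(1) by linarith
  then have "I k \<noteq> 0" using assms(2) by simp
  then show ?thesis by (simp add: multi_index_def)
qed

lemma cp_params_index:
  assumes "\<And>n. n < N \<Longrightarrow> A n \<in> carrier_mat (I n) R"
  shows "dim_vec (cp_params N A) = R * (\<Sum>l<N. I l)"
    and "n < N \<Longrightarrow> p < R * I n \<Longrightarrow> cp_params N A $ (R * (\<Sum>l<n. I l) + p) = vec_mat (A n) $ p"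
proof -
  let ?L = "\<lambda>N. concat (map (\<lambda>n. list_of_vec (vec_mat (A n))) [0..<N])"
  have len: "length (?L M) = R * (\<Sum>l<M. I l)" if "M \<le> N" for M
    using that
  proof (induction M)
    case (Suc M)
    then have "A M \<in> carrier_mat (I M) R" using assms[of M] by simp
    with Suc show ?case by (simp add: algebra_simps)
  qed simp
  then show "dim_vec (cp_params N A) = R * (\<Sum>l<N. I l)"
    by (simp add: cp_params_def)
  have "?L M ! (R * (\<Sum>l<n. I l) + p) = vec_mat (A n) $ p"
    if "M \<le> N" "n < M" "p < R * I n" for M
    using that
  proof (induction M)
    case (Suc M)
    have AM: "A M \<in> carrier_mat (I M) R" using assms[of M] Suc.prems by simp
    show ?case
    proof (cases "n = M")
      case True
      then show ?thesis using Suc.prems AM len[of M]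
        by (simp add: nth_append mult.commute)
    next
      case False
      then have nM: "n < M" using Suc.prems by simp
      have "R * (\<Sum>l<n. I l) + p < R * (\<Sum>l<Suc n. I l)"
        using Suc.prems by (simp add: algebra_simps)
      also have "\<dots> \<le> R * (\<Sum>l<M. I l)"
        using nM by (intro mult_left_mono sum_mono2) auto
      finally show ?thesis using Suc nM len[of M] by (simp add: nth_append)
    qed
  qed simp
  then show "n < N \<Longrightarrow> p < R * I n \<Longrightarrow>
      cp_params N A $ (R * (\<Sum>l<n. I l) + p) = vec_mat (A n) $ p"
    by (simp add: cp_params_def vec_of_list_index)
qed

lemma entry_index_less:
  fixes i k r R :: nat
  assumes "i < k" "r < R"
  shows "r * k + i < R * k"
proof -
  have "r * k + i < Suc r * k" using assms by simp
  also have "\<dots> \<le> R * k" using assms by (intro mult_right_mono) auto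
  finally show ?thesis .
qed

lemma cp_factor_cp_params:
  assumes "\<And>n. n < N \<Longrightarrow> A n \<in> carrier_mat (I n) R" and "n < N"
  shows "cp_factor I R (cp_params N A) n = A n"
proof (rule eq_matI)
  fix i r assume "i < dim_row (A n)" "r < dim_col (A n)"
  then have *: "i < I n" "r < R" using assms(1)[OF assms(2)] by auto
  have "r * I n + i < R * I n" by (rule entry_index_less[OF *])
  then have "cp_params N A $ (R * (\<Sum>l<n. I l) + (r * I n + i)) = vec_mat (A n) $ (r * I n + i)"
    using cp_params_index(2)[where N = N and A = A and I = I and R = R] assms by blast
  also have "\<dots> = A n $$ (i, r)"
    using * assms(1)[OF assms(2)] \<open>r * I n + i < R * I n\<close>
    by (auto simp: vec_mat_def mult.commute)
  finally show "cp_factor I R (cp_params N A) n $$ (i, r) = A n $$ (i, r)"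
    using * by (simp add: cp_factor_def add.assoc)
qed (use assms(1)[OF assms(2)] in \<open>auto simp: cp_factor_def\<close>)

(* Hence every deriv in the Jacobian of the CP model is a genuine derivative. *)
lemma cp_model_partial_differentiable:
  assumes x: "dim_vec x = R * (\<Sum>l<N. I l)" and p: "p < (\<Prod>k<N. I k)"
  shows "(\<lambda>t. cp_model N I R (x + t \<cdot>\<^sub>v unit_vec (dim_vec x) q) $ p) field_differentiable (at s)"
proof -
  define e where "e = (unit_vec (dim_vec x) q :: real vec)"
  define h where "h r n = R * (\<Sum>l<n. I l) + r * I n + multi_index I p n" for r n
  have h: "h r n < dim_vec x" if "r < R" "n < N" for r n
  proof -
    have "h r n < R * (\<Sum>l<Suc n. I l)"
      using entry_index_less[OF multi_index_less[OF p that(2)] that(1)]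
      by (simp add: h_def algebra_simps)
    also have "\<dots> \<le> R * (\<Sum>l<N. I l)"
      using that by (intro mult_left_mono sum_mono2) auto
    finally show ?thesis using x by simp
  qed
  have e: "dim_vec e = dim_vec x" by (simp add: e_def)
  have "cp_model N I R (x + t \<cdot>\<^sub>v e) $ p = (\<Sum>r<R. \<Prod>n<N. x $ h r n + t * e $ h r n)" for t
  proof -
    have "col (cp_factor I R (x + t \<cdot>\<^sub>v e) n) r $ multi_index I p n = x $ h r n + t * e $ h r n"
      if "r < R" "n < N" for r n
      using h[OF that] that multi_index_less[OF p that(2)] e
      by (simp add: cp_factor_def h_def)
    then show ?thesis
      using p by (simp add: cp_model_def vec_tensor_def cp_tensor_def outer_prod_def)
  qed
  then have "(\<lambda>t. cp_model N I R (x + t \<cdot>\<^sub>v e) $ p)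
      = (\<lambda>t. \<Sum>r<R. \<Prod>n<N. x $ h r n + t * e $ h r n)" by simp
  moreover have "((\<lambda>t. \<Prod>n<N. x $ h r n + t * e $ h r n) has_field_derivative
      (\<Sum>n<N. e $ h r n * (\<Prod>m\<in>{..<N} - {n}. x $ h r m + s * e $ h r m))) (at s)" for r
    by (rule DERIV_cong[OF has_field_derivative_prod])
      (auto intro!: derivative_eq_intros simp: mult.commute)
  then have "((\<lambda>t. \<Sum>r<R. \<Prod>n<N. x $ h r n + t * e $ h r n) has_field_derivative
      (\<Sum>r<R. \<Sum>n<N. e $ h r n * (\<Prod>m\<in>{..<N} - {n}. x $ h r m + s * e $ h r m))) (at s)"
    by (intro DERIV_sum)
  ultimately show ?thesis
    unfolding e_def field_differentiable_def by auto
qed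

lemma cp_carriers:
  assumes "\<And>n. n < N \<Longrightarrow> A n \<in> carrier_mat (I n) R"
  defines "T \<equiv> \<Sum>n<N. I n"
  shows "cp_jacobian N I R A \<in> carrier_mat (\<Prod>n<N. I n) (R * T)"
    and "cp_hessian N I R A \<in> carrier_mat (R * T) (R * T)"
    and "cp_G N I R A \<in> carrier_mat (R * T) (R * T)"
    and "cp_Z N R A \<in> carrier_mat (R * T) (N * R\<^sup>2)"
    and "cp_K N R A \<in> carrier_mat (N * R\<^sup>2) (N * R\<^sup>2)"
proof -
  show J: "cp_jacobian N I R A \<in> carrier_mat (\<Prod>n<N. I n) (R * T)"
    using cp_params_index(1)[OF assms(1)]
    by (simp add: cp_jacobian_def jacobian_def cp_model_def vec_tensor_def T_def)
  then show "cp_hessian N I R A \<in> carrier_mat (R * T) (R * T)"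
    by (simp add: cp_hessian_def)
  show "cp_K N R A \<in> carrier_mat (N * R\<^sup>2) (N * R\<^sup>2)"
    by (simp add: cp_K_def block_mat_def)
  have "sum_list (map (\<lambda>n. R * I n) [0..<N]) = R * T"
    by (simp add: T_def sum_distrib_left interv_sum_list_conv_sum_set_nat lessThan_atLeast0)
  then show "cp_G N I R A \<in> carrier_mat (R * T) (R * T)"
    by (intro carrier_matI)
      (simp_all add: cp_G_def dim_diag_block_mat comp_def kronecker_def cp_Gamma_def hadamard_prod_def)
  have eq: "map (\<lambda>n. R * dim_row (A n)) [0..<N] = map (\<lambda>n. R * I n) [0..<N]"
    "map (\<lambda>n. R * dim_col (A n)) [0..<N] = map (\<lambda>n. R\<^sup>2) [0..<N]"
    using assms(1)[THEN carrier_matD(1)] assms(1)[THEN carrier_matD(2)]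
    by (auto simp: power2_eq_square)
  have "dim_row (cp_Z N R A) = sum_list (map (\<lambda>n. R * dim_row (A n)) [0..<N])"
    "dim_col (cp_Z N R A) = sum_list (map (\<lambda>n. R * dim_col (A n)) [0..<N])"
    by (simp_all add: cp_Z_def dim_diag_block_mat comp_def kronecker_def)
  then show "cp_Z N R A \<in> carrier_mat (R * T) (N * R\<^sup>2)"
    unfolding eq \<open>sum_list (map (\<lambda>n. R * I n) [0..<N]) = R * T\<close>
    by (intro carrier_matI) (simp_all add: sum_list_triv)
qed

end

(* Each column of the Jacobian is indexed by a triple (n, r, i) (mode, component, row), and its entry
   at a multi-index x is the product over all modes k of A k (x k, r), with the n-th factor replaced by
   the indicator of x n = i. An entry of the Hessian is therefore a sum over all multi-indices of a
   product over modes, which factors into a product over modes of sums over single indices. The modes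
   other than n and m contribute Gram entries, that is, an entry of Gamma; the remaining one or two
   factors are an indicator (if n = m, the entry of G) or two entries of factor matrices (if n differs
   from m, the entry of Z K Z^T). *)
theory Submission
  imports Defs
begin

section \<open>Block decomposition of indices\<close>

lemma block_index_less:
  fixes w :: "nat \<Rightarrow> nat"
  assumes "n < N" "i < w n"
  shows "(\<Sum>l<n. w l) + i < (\<Sum>l<N. w l)"
proof -
  have "(\<Sum>l<n. w l) + i < (\<Sum>l<Suc n. w l)"
    using assms by simp
  also have "\<dots> \<le> (\<Sum>l<N. w l)"
    using assms by (intro sum_mono2) auto
  finally show ?thesis .
qed

text \<open>If \<open>n < m\<close>, then by \<open>block_index_less\<close> every position in block
  n lies below the offset of block m, so positions from different blocks never coincide.\<close>

lemma block_index_eq_iff: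
  fixes w :: "nat \<Rightarrow> nat"
  assumes "i < w n" "j < w m"
  shows "(\<Sum>l<n. w l) + i = (\<Sum>l<m. w l) + j \<longleftrightarrow> n = m \<and> i = j"
  using block_index_less[of n m i w] block_index_less[of m n j w] assms
  by (cases n m rule: linorder_cases) auto

lemma block_index_cases:
  fixes w :: "nat \<Rightarrow> nat"
  assumes "q < (\<Sum>l<N. w l)"
  obtains n i where "n < N" "i < w n" "q = (\<Sum>l<n. w l) + i"
proof -
  have "\<exists>n<N. \<exists>i<w n. q = (\<Sum>l<n. w l) + i"
    using assms
  proof (induction N)
    case (Suc N)
    show ?case
    proof (cases "q < (\<Sum>l<N. w l)")
      case True
      with Suc.IH show ?thesis using less_SucI by blast
    next
      case False
      with Suc.prems have "q - (\<Sum>l<N. w l) < w N" "q = (\<Sum>l<N. w l) + (q - (\<Sum>l<N. w l))"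
        by auto
      then show ?thesis by blast
    qed
  qed simp
  with that show thesis by blast
qed

lemma sum_blocks:
  fixes w :: "nat \<Rightarrow> nat"
  shows "(\<Sum>q<(\<Sum>l<N. w l). f q) = (\<Sum>n<N. \<Sum>i<w n. f ((\<Sum>l<n. w l) + i))"
proof (induction N)
  case (Suc N)
  have "(\<Sum>q<a + b. f q) = (\<Sum>q<a. f q) + (\<Sum>i<b. f (a + i))" for a b
    by (induction b) (auto simp: add.assoc)
  with Suc show ?case by simp
qed simp

lemma sum_blocks_uniform:
  "(\<Sum>q<n * k. f q) = (\<Sum>i<n. \<Sum>j<k. f (i * k + j))" for n k :: nat
  using sum_blocks[of f "\<lambda>_. k" n] by simp

section \<open>Entries of Kronecker products and block diagonal matrices\<close>

lemma kronecker_index: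
  assumes "A \<in> carrier_mat a b" "B \<in> carrier_mat c d" "r < a" "s < b" "i < c" "j < d"
  shows "(A \<otimes>\<^sub>K B) $$ (r * c + i, s * d + j) = A $$ (r, s) * B $$ (i, j)"
  using assms entry_index_less[of i c r a] entry_index_less[of j d s b]
  by (simp add: kronecker_def)

text \<open>\<open>diag_block_mat\<close> recurses on the head of its list, so the induction removes
  block 0 and needs its hypothesis for the families shifted by \<open>Suc\<close>; hence
  \<open>B\<close>, \<open>u\<close> and \<open>v\<close> are arbitrary.\<close>

lemma diag_block_mat_index:
  fixes B :: "nat \<Rightarrow> 'a::zero mat"
  assumes "\<And>l. l < N \<Longrightarrow> B l \<in> carrier_mat (u l) (v l)"
    and "n < N" "m < N" "i < u n" "j < v m"
  shows "diag_block_mat (map B [0..<N]) $$ ((\<Sum>l<n. u l) + i, (\<Sum>l<m. v l) + j)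
    = (if n = m then B n $$ (i, j) else 0)"
  using assms
proof (induction N arbitrary: B u v n m)
  case (Suc N)
  let ?D = "diag_block_mat (map (\<lambda>l. B (Suc l)) [0..<N])"
  have B: "B (Suc l) \<in> carrier_mat (u (Suc l)) (v (Suc l))" if "l < N" for l
    using Suc.prems(1)[of "Suc l"] that by simp
  have B0: "dim_row (B 0) = u 0" "dim_col (B 0) = v 0"
    using carrier_matD[OF Suc.prems(1)[of 0]] by simp_all
  have "map (\<lambda>l. dim_row (B (Suc l))) [0..<N] = map (\<lambda>l. u (Suc l)) [0..<N]"
    "map (\<lambda>l. dim_col (B (Suc l))) [0..<N] = map (\<lambda>l. v (Suc l)) [0..<N]"
    using B[THEN carrier_matD(1)] B[THEN carrier_matD(2)] by auto
  then have D: "dim_row ?D = (\<Sum>l<N. u (Suc l))" "dim_col ?D = (\<Sum>l<N. v (Suc l))"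
    by (simp_all add: dim_diag_block_mat comp_def interv_sum_list_conv_sum_set_nat lessThan_atLeast0)
  have split: "map B [0..<Suc N] = B 0 # map (\<lambda>l. B (Suc l)) [0..<N]"
    by (simp add: upt_conv_Cons map_Suc_upt[symmetric] comp_def del: upt_Suc)
  have row: "(\<Sum>l<n'. u (Suc l)) + i < dim_row ?D" if "n = Suc n'" for n'
    using block_index_less[of n' N i "\<lambda>l. u (Suc l)"] Suc.prems that D by simp
  have col: "(\<Sum>l<m'. v (Suc l)) + j < dim_col ?D" if "m = Suc m'" for m'
    using block_index_less[of m' N j "\<lambda>l. v (Suc l)"] Suc.prems that D by simp
  have IH: "?D $$ ((\<Sum>l<n'. u (Suc l)) + i, (\<Sum>l<m'. v (Suc l)) + j)
      = (if n' = m' then B (Suc n') $$ (i, j) else 0)" if "n = Suc n'" "m = Suc m'" for n' m'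
    using Suc.IH[of "\<lambda>l. B (Suc l)" "\<lambda>l. u (Suc l)" "\<lambda>l. v (Suc l)" n' m'] B Suc.prems that
    by simp
  show ?case
    using B0 row col IH Suc.prems(2-)
    by (cases n; cases m)
      (simp_all add: split Let_def sum.lessThan_Suc_shift add.assoc del: upt_Suc sum.lessThan_Suc)
qed simp

section \<open>Sums over multi-indices\<close>

text \<open>The distributive law, with p running through all multi-indices as mixed-radix digits.
  The induction splits off the last, slowest digit.\<close>

lemma sum_prod_multi_index:
  fixes f :: "nat \<Rightarrow> nat \<Rightarrow> 'a::comm_semiring_1"
  shows "(\<Sum>p<(\<Prod>k<N. I k). \<Prod>k<N. f k (multi_index I p k)) = (\<Prod>k<N. \<Sum>x<I k. f k x)"
proof (induction N)
  case (Suc N)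
  let ?P = "\<Prod>k<N. I k"
  have low: "multi_index I (x * ?P + p) k = multi_index I p k" if "k < N" for x p k
  proof (cases "?P = 0")
    case False
    \<comment> \<open>As \<open>k < N\<close>, the product of the sizes up to and including
      \<open>I k\<close> divides \<open>?P\<close>. Adding a multiple of \<open>?P\<close> thus
      changes the quotient behind digit k by a multiple of \<open>I k\<close>, which
      \<open>mod\<close> removes.\<close>
    have "?P = (\<Prod>l<Suc k. I l) * (\<Prod>l\<in>{Suc k..<N}. I l)"
      using that by (subst prod.union_disjoint[symmetric]) (auto intro!: prod.cong)
    then obtain c where c: "?P = (\<Prod>l<k. I l) * (I k * c)"
      by (metis mult.assoc prod.lessThan_Suc)
    have "x * ?P + p = p + (\<Prod>l<k. I l) * (I k * (x * c))"
      by (simp add: c algebra_simps)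
    moreover have "(\<Prod>l<k. I l) \<noteq> 0" using False c by auto
    ultimately show ?thesis
      by (simp only: multi_index_def div_mult_self2 mod_mult_self4 not_False_eq_True)
  qed (simp only: mult_0_right add_0)
  have high: "multi_index I (x * ?P + p) N = x" if "x < I N" "p < ?P" for x p
  proof -
    have "(x * P + p) div P = x" if "p < P" for P
      using that by (cases "P = 0") simp_all
    from this[OF \<open>p < ?P\<close>] \<open>x < I N\<close> show ?thesis
      by (simp only: multi_index_def mod_less)
  qed
  have "(\<Sum>p<(\<Prod>k<Suc N. I k). \<Prod>k<Suc N. f k (multi_index I p k))
      = (\<Sum>x<I N. \<Sum>p<?P. \<Prod>k<Suc N. f k (multi_index I (x * ?P + p) k))"
    by (simp add: mult.commute[of ?P] sum_blocks_uniform)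
  also have "\<dots> = (\<Sum>x<I N. \<Sum>p<?P. (\<Prod>k<N. f k (multi_index I p k)) * f N x)"
    by (intro sum.cong refl) (simp add: low high)
  also have "\<dots> = (\<Sum>p<?P. \<Prod>k<N. f k (multi_index I p k)) * (\<Sum>x<I N. f N x)"
    by (subst sum.swap) (simp add: sum_product)
  finally show ?case by (simp add: Suc)
qed simp

section \<open>The entries of both sides\<close>

text \<open>The position of entry (i, r) of factor n in \<open>cp_params\<close>. The offset is a
  sum of widths \<open>R * I l\<close>, the shape that the block lemmas expect; inside a factor, the
  columns are uniform blocks of width \<open>I n\<close>.\<close>

definition param_index :: "(nat \<Rightarrow> nat) \<Rightarrow> nat \<Rightarrow> nat \<Rightarrow> nat \<Rightarrow> nat \<Rightarrow> nat" where
  "param_index I R n r i = (\<Sum>l<n. R * I l) + (r * I n + i)"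

lemma param_index_less:
  assumes "n < N" "r < R" "i < I n"
  shows "param_index I R n r i < R * (\<Sum>l<N. I l)"
  using block_index_less[of n N "r * I n + i" "\<lambda>l. R * I l"] entry_index_less[of i "I n" r R] assms
  by (simp add: param_index_def sum_distrib_left)

text \<open>Uniqueness of block coordinates at two levels: factors within the parameter vector, then
  columns within a factor.\<close>

lemma param_index_eq_iff:
  assumes "r < R" "i < I n" "s < R" "j < I m"
  shows "param_index I R n r i = param_index I R m s j \<longleftrightarrow> n = m \<and> r = s \<and> i = j"
proof -
  have "r * I n + i = s * I n + j \<longleftrightarrow> r = s \<and> i = j" if "n = m"
    using block_index_eq_iff[of i "\<lambda>_. I n" r j s] assms that by simp
  then show ?thesis
    using block_index_eq_iff[of "r * I n + i" "\<lambda>l. R * I l" n "s * I m + j" m] assms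
      entry_index_less[of i "I n" r R] entry_index_less[of j "I m" s R]
    by (auto simp: param_index_def)
qed

lemma param_index_cases:
  assumes "q < R * (\<Sum>l<N. I l)"
  obtains n r i where "n < N" "r < R" "i < I n" "q = param_index I R n r i"
proof -
  have "q < (\<Sum>l<N. R * I l)" using assms by (simp add: sum_distrib_left)
  then obtain n e where n: "n < N" "e < R * I n" "q = (\<Sum>l<n. R * I l) + e"
    by (rule block_index_cases)
  have "e < (\<Sum>l<R. I n)" using n(2) by simp
  then obtain r i where "r < R" "i < I n" "e = (\<Sum>l<r. I n) + i"
    by (rule block_index_cases)
  with n that[of n r i] show thesis by (simp add: param_index_def)
qed

section \<open>Entries of the Jacobian and the Hessian\<close>

lemma cp_params_param_index:
  assumes "\<And>n. n < N \<Longrightarrow> A n \<in> carrier_mat (I n) R" "n < N" "r < R" "i < I n"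
  shows "cp_params N A $ param_index I R n r i = A n $$ (i, r)"
proof -
  have "cp_params N A $ param_index I R n r i = cp_factor I R (cp_params N A) n $$ (i, r)"
    using assms(3,4) by (simp add: cp_factor_def param_index_def sum_distrib_left add.assoc)
  then show ?thesis
    using assms cp_factor_cp_params[of N A I R n] by simp
qed

text \<open>Along a coordinate direction every factor of the model is affine in \<open>t\<close>, so
  the product rule gives the derivative, and only its term for mode n and component r
  survives.\<close>

lemma cp_jacobian_index:
  assumes A: "\<And>n. n < N \<Longrightarrow> A n \<in> carrier_mat (I n) R"
    and p: "p < (\<Prod>k<N. I k)" and n: "n < N" and r: "r < R" and i: "i < I n"
  shows "cp_jacobian N I R A $$ (p, param_index I R n r i)
    = (\<Prod>k<N. if k = n then of_bool (multi_index I p k = i) else A k $$ (multi_index I p k, r))"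
proof -
  define x where "x = cp_params N A"
  define q where "q = param_index I R n r i"
  define e where "e = (unit_vec (dim_vec x) q :: real vec)"
  let ?x = "multi_index I p"
  \<comment> \<open>The slope in \<open>t\<close> of the factor that component s reads in mode k: it
    is 1 exactly if the entry read is the perturbed one, (i, r) of factor n.\<close>
  define d where "d k s = (of_bool (k = n \<and> s = r \<and> ?x n = i) :: real)" for k s
  have dx: "dim_vec x = R * (\<Sum>l<N. I l)"
    using cp_params_index(1)[OF A] by (simp add: x_def)
  have mi: "?x k < I k" if "k < N" for k
    using multi_index_less[OF p that] .
  have e_at: "e $ param_index I R k s (?x k) = d k s"
    if "k < N" "s < R" for k s
    using param_index_less[where N = N and I = I and R = R, OF that mi[OF that(1)]]
      param_index_less[where N = N and I = I and R = R, OF n r i]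
      param_index_eq_iff[of s R "?x k" I k r i n] that mi r i
    by (auto simp: e_def q_def d_def dx)
  have "cp_model N I R (x + t \<cdot>\<^sub>v e) $ p
      = (\<Sum>s<R. \<Prod>k<N. A k $$ (?x k, s) + t * d k s)" for t
  proof -
    have "col (cp_factor I R (x + t \<cdot>\<^sub>v e) k) s $ ?x k
        = (x + t \<cdot>\<^sub>v e) $ param_index I R k s (?x k)" if "k < N" "s < R" for k s
      using that mi by (simp add: cp_factor_def param_index_def sum_distrib_left add.assoc)
    moreover have "(x + t \<cdot>\<^sub>v e) $ param_index I R k s (?x k)
        = A k $$ (?x k, s) + t * d k s" if "k < N" "s < R" for k s
    proof -
      have "param_index I R k s (?x k) < dim_vec e"
        using param_index_less[where N = N and I = I and R = R, OF that mi[OF that(1)]]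
        by (simp add: e_def dx)
      then show ?thesis
        using e_at[OF that] cp_params_param_index[where A = A and I = I, OF A that mi[OF that(1)]]
        by (simp add: x_def)
    qed
    ultimately show ?thesis
      using p by (simp add: cp_model_def vec_tensor_def cp_tensor_def outer_prod_def)
  qed
  moreover have "((\<lambda>t. \<Prod>k<N. A k $$ (?x k, s) + t * d k s)
      has_field_derivative (\<Sum>k<N. d k s
        * (\<Prod>m\<in>{..<N} - {k}. A m $$ (?x m, s)))) (at 0)" for s
    by (rule DERIV_cong[OF has_field_derivative_prod])
      (auto intro!: derivative_eq_intros simp: mult.commute)
  then have "((\<lambda>t. \<Sum>s<R. \<Prod>k<N. A k $$ (?x k, s) + t * d k s)
      has_field_derivative (\<Sum>s<R. \<Sum>k<N. d k s
        * (\<Prod>m\<in>{..<N} - {k}. A m $$ (?x m, s)))) (at 0)"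
    by (intro DERIV_sum)
  ultimately have "deriv (\<lambda>t. cp_model N I R (x + t \<cdot>\<^sub>v e) $ p) 0
      = (\<Sum>s<R. \<Sum>k<N. d k s * (\<Prod>m\<in>{..<N} - {k}. A m $$ (?x m, s)))"
    by (simp add: DERIV_imp_deriv)
  also have "\<dots> = (\<Sum>s<R. if s = r then
      \<Sum>k<N. if k = n then of_bool (?x n = i) * (\<Prod>m\<in>{..<N} - {k}. A m $$ (?x m, s)) else 0 else 0)"
    by (intro sum.cong refl) (auto simp: d_def intro!: sum.cong)
  also have "\<dots> = of_bool (?x n = i) * (\<Prod>m\<in>{..<N} - {n}. A m $$ (?x m, r))"
    using n r by (simp add: sum.delta del: sum_of_bool_mult_eq)
  \<comment> \<open>The indicator takes the place left free by mode n. The entry becomes a product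
    over all modes, as \<open>sum_prod_multi_index\<close> requires.\<close>
  also have "\<dots> = (\<Prod>k<N. if k = n then of_bool (?x k = i) else A k $$ (?x k, r))"
    using n by (subst (2) prod.remove[of _ n]) (auto intro!: prod.cong)
  finally show ?thesis
    using p dx param_index_less[where N = N and I = I and R = R, OF n r i]
    by (simp add: cp_jacobian_def jacobian_def cp_model_def vec_tensor_def x_def e_def q_def)
qed

lemma cp_gram_index:
  assumes "A k \<in> carrier_mat a R" "r < R" "s < R"
  shows "cp_gram A k $$ (r, s) = (\<Sum>x<a. A k $$ (x, r) * A k $$ (x, s))"
  using assms by (auto simp: cp_gram_def scalar_prod_def lessThan_atLeast0)

text \<open>For distinct modes the components cross: in mode n the first column gives the indicator
  of i and the second an entry of component s, while mode m gives component r. This crossing is what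
  the commutation matrix in \<open>cp_K\<close> reproduces.\<close>

lemma cp_hessian_index:
  assumes A: "\<And>n. n < N \<Longrightarrow> A n \<in> carrier_mat (I n) R"
    and n: "n < N" "r < R" "i < I n" and m: "m < N" "s < R" "j < I m"
  shows "cp_hessian N I R A $$ (param_index I R n r i, param_index I R m s j)
    = (if n = m then of_bool (i = j) else A n $$ (i, s) * A m $$ (j, r))
      * cp_Gamma N R A n m $$ (r, s)"
proof -
  let ?J = "cp_jacobian N I R A"
  \<comment> \<open>The contribution of mode k to the product of the two Jacobian columns.\<close>
  define F where "F k x = (if k = n then of_bool (x = i) else A k $$ (x, r))
    * (if k = m then of_bool (x = j) else A k $$ (x, s))" for k x
  have J: "?J \<in> carrier_mat (\<Prod>n<N. I n) (R * (\<Sum>n<N. I n))"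
    by (rule cp_carriers(1)) (rule A)
  have "cp_hessian N I R A $$ (param_index I R n r i, param_index I R m s j)
      = (\<Sum>p<(\<Prod>k<N. I k). ?J $$ (p, param_index I R n r i) * ?J $$ (p, param_index I R m s j))"
    using J param_index_less[where N = N and I = I and R = R, OF n]
      param_index_less[where N = N and I = I and R = R, OF m]
    by (simp add: cp_hessian_def scalar_prod_def lessThan_atLeast0)
  also have "\<dots> = (\<Sum>p<(\<Prod>k<N. I k). \<Prod>k<N. F k (multi_index I p k))"
  proof (intro sum.cong refl)
    fix p assume "p \<in> {..<\<Prod>k<N. I k}"
    then have p: "p < (\<Prod>k<N. I k)" by simp
    have "?J $$ (p, param_index I R n r i)
        = (\<Prod>k<N. if k = n then of_bool (multi_index I p k = i) else A k $$ (multi_index I p k, r))"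
      by (rule cp_jacobian_index[OF A p n])
    moreover have "?J $$ (p, param_index I R m s j)
        = (\<Prod>k<N. if k = m then of_bool (multi_index I p k = j) else A k $$ (multi_index I p k, s))"
      by (rule cp_jacobian_index[OF A p m])
    ultimately show "?J $$ (p, param_index I R n r i) * ?J $$ (p, param_index I R m s j)
        = (\<Prod>k<N. F k (multi_index I p k))"
      by (simp only: F_def prod.distrib)
  qed
  also have "\<dots> = (\<Prod>k<N. \<Sum>x<I k. F k x)"
    by (rule sum_prod_multi_index)
  \<comment> \<open>The set \<open>{n, m}\<close> collapses to one mode when \<open>n = m\<close>,
    so a single split serves both cases.\<close>
  also have "\<dots> = (\<Prod>k\<in>{n, m}. \<Sum>x<I k. F k x) * (\<Prod>k\<in>{..<N} - {n, m}. \<Sum>x<I k. F k x)"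
    using n m by (subst prod.subset_diff[of "{n, m}"]) (auto simp: mult.commute)
  also have "(\<Prod>k\<in>{..<N} - {n, m}. \<Sum>x<I k. F k x) = cp_Gamma N R A n m $$ (r, s)"
    using n m cp_gram_index[where A = A, OF A]
    by (auto simp: F_def cp_Gamma_def hadamard_prod_def intro!: prod.cong)
  also have "(\<Prod>k\<in>{n, m}. \<Sum>x<I k. F k x)
      = (if n = m then of_bool (i = j) else A n $$ (i, s) * A m $$ (j, r))"
  proof (cases "n = m")
    case True
    have "(\<Sum>x<I n. F n x) = (\<Sum>x<I n. if x = i then of_bool (i = j) else 0)"
      using True by (intro sum.cong) (auto simp: F_def)
    with True n show ?thesis by simp
  next
    case False
    have "(\<Sum>x<I n. F n x) = (\<Sum>x<I n. if x = i then A n $$ (i, s) else 0)"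
      "(\<Sum>x<I m. F m x) = (\<Sum>x<I m. if x = j then A m $$ (j, r) else 0)"
      using False by (auto simp: F_def intro!: sum.cong)
    with False n m show ?thesis by simp
  qed
  finally show ?thesis .
qed

section \<open>Entries of G, Z, K and the product with Z on both sides\<close>

lemma cp_G_index:
  assumes n: "n < N" "r < R" "i < I n" and m: "m < N" "s < R" "j < I m"
  shows "cp_G N I R A $$ (param_index I R n r i, param_index I R m s j)
    = (if n = m then of_bool (i = j) * cp_Gamma N R A n n $$ (r, s) else 0)"
proof -
  have \<Gamma>: "cp_Gamma N R A l l \<in> carrier_mat R R" for l
    by (simp add: cp_Gamma_def hadamard_prod_def)
  have "cp_Gamma N R A l l \<otimes>\<^sub>K 1\<^sub>m (I l) \<in> carrier_mat (R * I l) (R * I l)" for l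
    using \<Gamma>[of l] by (simp add: kronecker_def)
  then have "cp_G N I R A $$ (param_index I R n r i, param_index I R m s j)
      = (if n = m then (cp_Gamma N R A n n \<otimes>\<^sub>K 1\<^sub>m (I n)) $$ (r * I n + i, s * I m + j) else 0)"
    unfolding cp_G_def param_index_def using assms entry_index_less
    by (intro diag_block_mat_index) auto
  then show ?thesis
    using kronecker_index[OF \<Gamma> one_carrier_mat, of r s i "I n" j n] assms by auto
qed

text \<open>A column of Z is given by a block m, a component s from the identity factor and a column
  c of \<open>A m\<close>. Each row of Z is thus supported on one run of R columns.\<close>

lemma cp_Z_index:
  assumes A: "\<And>n. n < N \<Longrightarrow> A n \<in> carrier_mat (I n) R"
    and n: "n < N" "r < R" "i < I n" and m: "m < N" "s < R" "c < R"
  shows "cp_Z N R A $$ (param_index I R n r i, m * R\<^sup>2 + (s * R + c))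
    = (if n = m \<and> r = s then A n $$ (i, c) else 0)"
proof -
  have "1\<^sub>m R \<otimes>\<^sub>K A l \<in> carrier_mat (R * I l) (R\<^sup>2)" if "l < N" for l
    using A[OF that] by (simp add: kronecker_def power2_eq_square)
  then have "cp_Z N R A $$ ((\<Sum>l<n. R * I l) + (r * I n + i), (\<Sum>l<m. R\<^sup>2) + (s * R + c))
      = (if n = m then (1\<^sub>m R \<otimes>\<^sub>K A n) $$ (r * I n + i, s * R + c) else 0)"
    unfolding cp_Z_def using n m entry_index_less
    by (intro diag_block_mat_index) (auto simp: power2_eq_square)
  then show ?thesis
    using kronecker_index[OF one_carrier_mat A[OF n(1)], of r R s i c] n m
    by (auto simp: param_index_def)
qed

text \<open>The diagonal factor scales column \<open>s * R + d\<close> of the commutation matrix by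
  the entry (d, s) of Gamma. The commutation matrix is nonzero there only for \<open>c = s\<close>
  and \<open>r = d\<close>, which turns (d, s) into (r, s).\<close>

lemma cp_K_index:
  assumes n: "n < N" "r < R" "c < R" and m: "m < N" "s < R" "d < R"
  shows "cp_K N R A $$ (n * R\<^sup>2 + (r * R + c), m * R\<^sup>2 + (s * R + d))
    = (if n \<noteq> m \<and> c = s \<and> r = d then cp_Gamma N R A n m $$ (r, s) else 0)"
proof -
  let ?g = "\<lambda>q. vec_mat (cp_Gamma N R A n m) $ q"
  have \<Gamma>: "dim_row (cp_Gamma N R A n m) = R" "dim_col (cp_Gamma N R A n m) = R"
    by (simp_all add: cp_Gamma_def hadamard_prod_def)
  have less: "r * R + c < R\<^sup>2" "s * R + d < R\<^sup>2"
    using n m entry_index_less by (auto simp: power2_eq_square)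
  have P: "commutation_mat R \<in> carrier_mat (R\<^sup>2) (R\<^sup>2)"
    by (simp add: commutation_mat_def)
  have "(commutation_mat R * mat_diag (R\<^sup>2) ?g) $$ (r * R + c, s * R + d)
      = commutation_mat R $$ (r * R + c, s * R + d) * ?g (s * R + d)"
    using less by (simp add: mat_diag_mult_right[OF P])
  also have "\<dots> = (if c = s \<and> r = d then cp_Gamma N R A n m $$ (r, s) else 0)"
    using less n m \<Gamma> by (auto simp: commutation_mat_def vec_mat_def power2_eq_square)
  finally have "((1 - of_bool (n = m)) \<cdot>\<^sub>m (commutation_mat R * mat_diag (R\<^sup>2) ?g))
      $$ (r * R + c, s * R + d)
      = (if n \<noteq> m \<and> c = s \<and> r = d then cp_Gamma N R A n m $$ (r, s) else 0)"
    using less carrier_matD[OF mult_carrier_mat[OF P mat_diag_dim, of ?g]]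
    by (simp del: index_mult_mat)
  moreover have "(n * R\<^sup>2 + (r * R + c)) div R\<^sup>2 = n" "(n * R\<^sup>2 + (r * R + c)) mod R\<^sup>2 = r * R + c"
    "(m * R\<^sup>2 + (s * R + d)) div R\<^sup>2 = m" "(m * R\<^sup>2 + (s * R + d)) mod R\<^sup>2 = s * R + d"
    using less n(2) by simp_all
  ultimately show ?thesis
    using entry_index_less[OF less(1) n(1)] entry_index_less[OF less(2) m(1)]
    by (simp only: cp_K_def block_mat_def index_mat(1) split_conv)
qed

text \<open>The support of the rows of Z reduces the double sum to \<open>c, d < R\<close>. Off the
  diagonal blocks, K then selects the single term \<open>c = s\<close>,
  \<open>d = r\<close>.\<close>

lemma cp_ZKZ_index:
  assumes A: "\<And>n. n < N \<Longrightarrow> A n \<in> carrier_mat (I n) R"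
    and n: "n < N" "r < R" "i < I n" and m: "m < N" "s < R" "j < I m"
  shows "(cp_Z N R A * cp_K N R A * transpose_mat (cp_Z N R A))
      $$ (param_index I R n r i, param_index I R m s j)
    = (if n = m then 0 else A n $$ (i, s) * A m $$ (j, r) * cp_Gamma N R A n m $$ (r, s))"
proof -
  let ?Z = "cp_Z N R A" and ?K = "cp_K N R A"
  let ?a = "param_index I R n r i" and ?b = "param_index I R m s j"
  have Z: "?Z \<in> carrier_mat (R * (\<Sum>n<N. I n)) (N * R\<^sup>2)"
    by (rule cp_carriers(4)) (rule A)
  have K: "?K \<in> carrier_mat (N * R\<^sup>2) (N * R\<^sup>2)"
    by (rule cp_carriers(5)) (rule A)
  have triple: "(\<Sum>u<N * R\<^sup>2. f u) = (\<Sum>l<N. \<Sum>t<R. \<Sum>c<R. f (l * R\<^sup>2 + (t * R + c)))"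
    for f :: "nat \<Rightarrow> real"
    unfolding sum_blocks_uniform power2_eq_square ..
  \<comment> \<open>Contraction of an arbitrary \<open>f\<close> with a row of Z, used below for
    both outer factors.\<close>
  have row: "(\<Sum>u<N * R\<^sup>2. ?Z $$ (param_index I R l t x, u) * f u)
      = (\<Sum>c<R. A l $$ (x, c) * f (l * R\<^sup>2 + (t * R + c)))"
    if "l < N" "t < R" "x < I l" for l t x and f :: "nat \<Rightarrow> real"
  proof -
    have "(\<Sum>c<R. ?Z $$ (param_index I R l t x, l' * R\<^sup>2 + (t' * R + c)) * f (l' * R\<^sup>2 + (t' * R + c)))
        = (if l' = l then if t' = t then
            \<Sum>c<R. A l $$ (x, c) * f (l * R\<^sup>2 + (t * R + c)) else 0 else 0)"
      if "l' < N" "t' < R" for l' t'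
      using cp_Z_index[where A = A and I = I, OF A \<open>l < N\<close> \<open>t < R\<close> \<open>x < I l\<close> that] by auto
    then have "(\<Sum>u<N * R\<^sup>2. ?Z $$ (param_index I R l t x, u) * f u)
        = (\<Sum>l'<N. if l' = l then \<Sum>t'<R. if t' = t then
            \<Sum>c<R. A l $$ (x, c) * f (l * R\<^sup>2 + (t * R + c)) else 0 else 0)"
      unfolding triple by (intro sum.cong refl) simp
    with that show ?thesis by simp
  qed
  \<comment> \<open>The transposed factor is read through rows of Z, so that \<open>row\<close>
    applies to it as well.\<close>
  have "(?Z * ?K * transpose_mat ?Z) $$ (?a, ?b)
      = (\<Sum>u<N * R\<^sup>2. ?Z $$ (?a, u) * (\<Sum>v<N * R\<^sup>2. ?Z $$ (?b, v) * ?K $$ (u, v)))"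
    using Z K param_index_less[where N = N and I = I and R = R, OF n]
      param_index_less[where N = N and I = I and R = R, OF m]
    by (simp add: scalar_prod_def lessThan_atLeast0 mult.commute)
  also have "\<dots> = (\<Sum>c<R. A n $$ (i, c) * (\<Sum>d<R. A m $$ (j, d)
      * ?K $$ (n * R\<^sup>2 + (r * R + c), m * R\<^sup>2 + (s * R + d))))"
    unfolding row[OF n] row[OF m] ..
  also have "\<dots> = (\<Sum>c<R. if c = s then \<Sum>d<R. if d = r then
      if n = m then 0 else A n $$ (i, s) * A m $$ (j, r) * cp_Gamma N R A n m $$ (r, s) else 0 else 0)"
    using n m by (intro sum.cong refl) (auto simp: cp_K_index mult_delta_right)
  finally show ?thesis using n m by simp
qed

section \<open>Comparison of the two sides entry by entry\<close>

theorem theorem4p2: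
  fixes N R :: nat and I :: "nat \<Rightarrow> nat" and A :: "nat \<Rightarrow> real mat"
  assumes "N \<ge> 2"
    and "\<And>n. n < N \<Longrightarrow> A n \<in> carrier_mat (I n) R"
  shows "cp_hessian N I R A = cp_G N I R A + cp_Z N R A * cp_K N R A * transpose_mat (cp_Z N R A)"
proof -
  define T where "T = (\<Sum>n<N. I n)"
  note A = assms(2)
  let ?M = "cp_Z N R A * cp_K N R A * transpose_mat (cp_Z N R A)"
  have H: "cp_hessian N I R A \<in> carrier_mat (R * T) (R * T)"
    unfolding T_def by (rule cp_carriers(2)) (rule A)
  have "cp_Z N R A \<in> carrier_mat (R * T) (N * R\<^sup>2)"
    unfolding T_def by (rule cp_carriers(4)) (rule A)
  then have M: "?M \<in> carrier_mat (R * T) (R * T)"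
    by (intro carrier_matI) auto
  show ?thesis
  proof (rule eq_matI)
    fix a b
    assume "a < dim_row (cp_G N I R A + ?M)" "b < dim_col (cp_G N I R A + ?M)"
    \<comment> \<open>A matrix sum takes its dimensions from the right summand, so the bounds come
      from the carrier of \<open>?M\<close>.\<close>
    then have ab: "a < R * T" "b < R * T"
      by (simp_all only: index_add_mat carrier_matD[OF M])
    obtain n r i where n: "n < N" "r < R" "i < I n" and a: "a = param_index I R n r i"
      using ab(1) unfolding T_def by (rule param_index_cases)
    obtain m s j where m: "m < N" "s < R" "j < I m" and b: "b = param_index I R m s j"
      using ab(2) unfolding T_def by (rule param_index_cases)
    have "(cp_G N I R A + ?M) $$ (a, b) = cp_G N I R A $$ (a, b) + ?M $$ (a, b)"
      by (rule index_add_mat) (simp_all only: carrier_matD[OF M] ab)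
    \<comment> \<open>For \<open>n = m\<close> only G contributes, otherwise only \<open>?M\<close>;
      in both cases the remaining term is the Hessian entry.\<close>
    also have "\<dots> = cp_hessian N I R A $$ (a, b)"
      by (simp only: a b cp_hessian_index[where A = A and I = I, OF A n m]
          cp_G_index[where A = A and I = I, OF n m] cp_ZKZ_index[where A = A and I = I, OF A n m]) simp
    finally show "cp_hessian N I R A $$ (a, b) = (cp_G N I R A + ?M) $$ (a, b)" ..
  qed (simp_all only: index_add_mat carrier_matD[OF H] carrier_matD[OF M])
qed

end
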